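(* Let $P=(L,\ell_0,G,\ell_\mathrm{err})$ and $P'=(L',\ell'_0,G',\ell'_\mathrm{err})$ be control-flow automata and let $DG(P,P')=(N,E,n_0,\Delta)$ be a difference graph for $P$ and $P'$ (for instance, the output of any difference detector). Let $A$ be the condition returned by the condition generator (described in the context) on input $DG(P,P')$. Then $A$ covers no path with a regression bug, i.e. $cover(A)\cap paths^\mathrm{rb}(P,P')=\emptyset$.
   Context: Programs operate on variables; a concrete data state $c$ assigns a value to every variable. $Ops$ is a set of operations, each either an assignment or an assume operation. An assume operation $op$ is a predicate on data states (write $c\models op$); for an assignment $op$, $SP_{op}(c)$ denotes the data state after executing $op$ in $c$. A control-flow automaton (CFA) $P=(L,\ell_0,G,\ell_\mathrm{err})$ consists of a set $L$ of locations, an initial location $\ell_0\in L$, an error location $\ell_\mathrm{err}\in L$, and control-flow edges $G\subseteq L\times Ops\times L$. An executable program path of $P$ is a sequence $(\ell_0,c_0)\xrightarrow{g_1}(\ell_1,c_1)\xrightarrow{g_2}\cdots\xrightarrow{g_n}(\ell_n,c_n)$, $n\ge 0$, starting at $\ell_0$ with an arbitrary data state $c_0$, such that for each $1\le i\le n$, $g_i=(\ell_{i-1},op_i,\ell_i)\in G$ and: if $op_i$ is an assume operation then $c_{i-1}\models op_i$ and $c_i=c_{i-1}$; if $op_i$ is an assignment then $c_i=SP_{op_i}(c_{i-1})$. $paths^\mathrm{err}(P)$ is the set of executable paths of $P$ that visit $\ell_\mathrm{err}$ (some $\ell_i=\ell_\mathrm{err}$). For an original CFA $P$ and a modified CFA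 $P'$, $paths^\mathrm{rb}(P,P')$ (paths with regression bugs) is the set of $\pi'\in paths^\mathrm{err}(P')$ with initial data state $c'_0$ such that there is no $\pi\in paths^\mathrm{err}(P)$ whose initial data state equals $c'_0$. A difference graph $DG(P,P')=(N,E,n_0,\Delta)$ consists of a set $N$ of nodes, an initial node $n_0\in N$, a set $\Delta\subseteq N$ of regression-bug indicator nodes, and edges $E\subseteq N\times G'\times N$, such that: for every $\pi'=(\ell'_0,c'_0)\xrightarrow{g'_1}\cdots\xrightarrow{g'_n}(\ell'_n,c'_n)\in paths^\mathrm{rb}(P,P')$, every $0\le k\le n$ and every sequence $n_0\xrightarrow{g'_1}n_1\cdots\xrightarrow{g'_k}n_k$ with $(n_{i-1},g'_i,n_i)\in E$ for all $i$, there is a sequence $n_k\to n_{k+1}\to\cdots\to n_{k+m}$ of edges of $E$ ($m\ge 0$) with $n_{k+m}\in\Delta$. A condition $A=(Q,\delta,q_0,F)$ consists of a finite set $Q$ of states, initial state $q_0\in Q$, accepting states $F\subseteq Q$, and a transition relation $\delta\subseteq Q\times G'\times Q$ such that no transition leaves an accepting state. $A$ covers an executable path $(\ell'_0,c'_0)\xrightarrow{g'_1}\cdots\xrightarrow{g'_n}(\ell'_n,c'_n)$ of $P'$ (written $\pi'\in cover(A)$) if there is a run $q_0\xrightarrow{g'_1}q_1\cdots\xrightarrow{g'_k}q_k$ with $(q_{i-1},g'_i,q_i)\in\delta$, $0\le k\le n$, and $q_k\in F$. Condition generator on input $(N,E,n_0,\Delta)$: set $Q:=\{n_0\}\cup\Delta$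 and $waitlist:=\{n_0\}\cup\Delta$. While $waitlist\neq\emptyset$: remove some $n_s$ from $waitlist$, and for each edge $(n_p,g,n_s)\in E$ with $n_p\notin Q$, add $n_p$ to $Q$ and to $waitlist$. Then let $F:=\{n_s\mid \exists (n_p,g,n_s)\in E,\ n_p\in Q,\ n_s\notin Q\}$ and return the condition $(Q\cup F,\ E\cap(Q\times G'\times(Q\cup F)),\ n_0,\ F)$. *)

theory Defs
  imports Main
begin

section \<open>Programs\<close>

type_synonym ('var, 'val) data_state = "'var \<Rightarrow> 'val"

text \<open>
  Assignments are left abstract: their meaning is given by a parameter \<open>SP\<close>, where \<open>SP a c\<close> is the
  data state after executing \<open>a\<close> in \<open>c\<close>. The set of operations is the whole type below.
\<close>

datatype ('asg, 'var, 'val) operation =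
    Assign 'asg
  | Assume "('var, 'val) data_state \<Rightarrow> bool"

record ('l, 'op) cfa =
  locs :: "'l set"
  init_loc :: 'l
  cfa_edges :: "('l \<times> 'op \<times> 'l) set"
  err_loc :: 'l

definition wf_cfa :: "('l, 'op) cfa \<Rightarrow> bool" where
  "wf_cfa P \<longleftrightarrow>
     init_loc P \<in> locs P \<and> err_loc P \<in> locs P \<and> cfa_edges P \<subseteq> locs P \<times> UNIV \<times> locs P"

fun exec_op ::
  "('asg \<Rightarrow> ('var, 'val) data_state \<Rightarrow> ('var, 'val) data_state) \<Rightarrow>
   ('asg, 'var, 'val) operation \<Rightarrow> ('var, 'val) data_state \<Rightarrow> ('var, 'val) data_state \<Rightarrow> bool"
where
  "exec_op SP (Assume p) c c' \<longleftrightarrow> p c \<and> c' = c"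
| "exec_op SP (Assign a) c c' \<longleftrightarrow> c' = SP a c"

text \<open>
  The path from \<open>(l\<^sub>0, c\<^sub>0)\<close> via \<open>g\<^sub>1, \<dots>, g\<^sub>n\<close> to \<open>(l\<^sub>n, c\<^sub>n)\<close> is the pair consisting of the list of its
  \<open>n + 1\<close> configurations and the list of its \<open>n\<close> control-flow edges. The edge list is indexed
  from 0, so that \<open>g\<^sub>i\<^sub>+\<^sub>1\<close> is \<open>gs ! i\<close>.
\<close>

type_synonym ('l, 'asg, 'var, 'val) path =
  "('l \<times> ('var, 'val) data_state) list \<times> ('l \<times> ('asg, 'var, 'val) operation \<times> 'l) list"

definition exec_paths ::
  "('asg \<Rightarrow> ('var, 'val) data_state \<Rightarrow> ('var, 'val) data_state) \<Rightarrow>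
   ('l, ('asg, 'var, 'val) operation) cfa \<Rightarrow> ('l, 'asg, 'var, 'val) path set"
where
  "exec_paths SP P =
     {(cs, gs). length cs = length gs + 1 \<and> fst (cs ! 0) = init_loc P \<and>
        (\<forall>i < length gs. gs ! i \<in> cfa_edges P \<and>
           (\<exists>op. gs ! i = (fst (cs ! i), op, fst (cs ! Suc i)) \<and>
                 exec_op SP op (snd (cs ! i)) (snd (cs ! Suc i))))}"

definition initial_data :: "('l, 'asg, 'var, 'val) path \<Rightarrow> ('var, 'val) data_state" where
  "initial_data \<pi> = snd (fst \<pi> ! 0)"

definition paths_err ::
  "('asg \<Rightarrow> ('var, 'val) data_state \<Rightarrow> ('var, 'val) data_state) \<Rightarrow>
   ('l, ('asg, 'var, 'val) operation) cfa \<Rightarrow> ('l, 'asg, 'var, 'val) path set"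
where
  "paths_err SP P = {\<pi> \<in> exec_paths SP P. \<exists>(l, c) \<in> set (fst \<pi>). l = err_loc P}"

definition paths_rb ::
  "('asg \<Rightarrow> ('var, 'val) data_state \<Rightarrow> ('var, 'val) data_state) \<Rightarrow>
   ('l, ('asg, 'var, 'val) operation) cfa \<Rightarrow> ('m, ('asg, 'var, 'val) operation) cfa \<Rightarrow>
   ('m, 'asg, 'var, 'val) path set"
where
  "paths_rb SP P P' =
     {\<pi>' \<in> paths_err SP P'. \<not> (\<exists>\<pi> \<in> paths_err SP P. initial_data \<pi> = initial_data \<pi>')}"


section \<open>Difference graphs and conditions\<close>

inductive run :: "('n \<times> 'g \<times> 'n) set \<Rightarrow> 'n \<Rightarrow> 'g list \<Rightarrow> 'n \<Rightarrow> bool" for E where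
  run_Nil: "run E n [] n"
| run_Cons: "(n, g, n') \<in> E \<Longrightarrow> run E n' gs n'' \<Longrightarrow> run E n (g # gs) n''"

record ('n, 'g) diff_graph =
  dg_nodes :: "'n set"
  dg_edges :: "('n \<times> 'g \<times> 'n) set"
  dg_init :: 'n
  dg_indicators :: "'n set"

definition difference_graph ::
  "('asg \<Rightarrow> ('var, 'val) data_state \<Rightarrow> ('var, 'val) data_state) \<Rightarrow>
   ('l, ('asg, 'var, 'val) operation) cfa \<Rightarrow> ('m, ('asg, 'var, 'val) operation) cfa \<Rightarrow>
   ('n, 'm \<times> ('asg, 'var, 'val) operation \<times> 'm) diff_graph \<Rightarrow> bool"
where
  "difference_graph SP P P' D \<longleftrightarrow>
     dg_init D \<in> dg_nodes D \<and>
     dg_indicators D \<subseteq> dg_nodes D \<and>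
     dg_edges D \<subseteq> dg_nodes D \<times> cfa_edges P' \<times> dg_nodes D \<and>
     (\<forall>(cs, gs) \<in> paths_rb SP P P'. \<forall>k \<le> length gs. \<forall>n.
        run (dg_edges D) (dg_init D) (take k gs) n \<longrightarrow>
        (\<exists>hs. \<exists>n' \<in> dg_indicators D. run (dg_edges D) n hs n'))"

record ('q, 'g) condition =
  states :: "'q set"
  trans_rel :: "('q \<times> 'g \<times> 'q) set"
  init_state :: 'q
  accepting :: "'q set"

definition wf_condition :: "('m, 'op) cfa \<Rightarrow> ('q, 'm \<times> 'op \<times> 'm) condition \<Rightarrow> bool" where
  "wf_condition P' A \<longleftrightarrow>
     finite (states A) \<and> init_state A \<in> states A \<and> accepting A \<subseteq> states A \<and>
     trans_rel A \<subseteq> states A \<times> cfa_edges P' \<times> states A \<and>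
     (\<forall>(q, g, q') \<in> trans_rel A. q \<notin> accepting A)"

definition cover ::
  "('asg \<Rightarrow> ('var, 'val) data_state \<Rightarrow> ('var, 'val) data_state) \<Rightarrow>
   ('m, ('asg, 'var, 'val) operation) cfa \<Rightarrow>
   ('q, 'm \<times> ('asg, 'var, 'val) operation \<times> 'm) condition \<Rightarrow> ('m, 'asg, 'var, 'val) path set"
where
  "cover SP P' A =
     {(cs, gs) \<in> exec_paths SP P'.
        \<exists>k \<le> length gs. \<exists>q \<in> accepting A. run (trans_rel A) (init_state A) (take k gs) q}"


section \<open>The condition generator\<close>

text \<open>
  One iteration of the while loop on \<open>(Q, waitlist)\<close>. It is a relation because the removed node is
  an arbitrary element of the waitlist.
\<close>

inductive gen_step ::
  "('n, 'g) diff_graph \<Rightarrow> 'n set \<times> 'n set \<Rightarrow> 'n set \<times> 'n set \<Rightarrow> bool" for D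
where
  "n\<^sub>s \<in> W \<Longrightarrow> new = {n\<^sub>p. n\<^sub>p \<notin> Q \<and> (\<exists>g. (n\<^sub>p, g, n\<^sub>s) \<in> dg_edges D)} \<Longrightarrow>
   gen_step D (Q, W) (Q \<union> new, (W - {n\<^sub>s}) \<union> new)"

definition gen_accepting :: "('n, 'g) diff_graph \<Rightarrow> 'n set \<Rightarrow> 'n set" where
  "gen_accepting D Q = {n\<^sub>s. \<exists>n\<^sub>p g. (n\<^sub>p, g, n\<^sub>s) \<in> dg_edges D \<and> n\<^sub>p \<in> Q \<and> n\<^sub>s \<notin> Q}"

definition gen_output ::
  "('m, 'op) cfa \<Rightarrow> ('n, 'm \<times> 'op \<times> 'm) diff_graph \<Rightarrow> 'n set \<Rightarrow> ('n, 'm \<times> 'op \<times> 'm) condition"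
where
  "gen_output P' D Q =
     (let F = gen_accepting D Q
      in \<lparr>states = Q \<union> F,
          trans_rel = dg_edges D \<inter> (Q \<times> cfa_edges P' \<times> (Q \<union> F)),
          init_state = dg_init D,
          accepting = F\<rparr>)"

text \<open>
  \<open>generates P' D A\<close>: some run of the generator on \<open>D\<close> terminates and returns \<open>A\<close>.
  Nothing is assumed about the finiteness of \<open>D\<close>; for finite \<open>D\<close> the loop always terminates
  (\<open>wfp_gen_step\<close>) and every returned tuple is a condition (\<open>wf_condition_generates\<close>).
\<close>

definition generates ::
  "('m, 'op) cfa \<Rightarrow> ('n, 'm \<times> 'op \<times> 'm) diff_graph \<Rightarrow> ('n, 'm \<times> 'op \<times> 'm) condition \<Rightarrow> bool"
where
  "generates P' D A \<longleftrightarrow>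
     (\<exists>Q. (gen_step D)\<^sup>*\<^sup>* ({dg_init D} \<union> dg_indicators D, {dg_init D} \<union> dg_indicators D) (Q, {}) \<and>
          A = gen_output P' D Q)"

lemma gen_step_invariant:
  assumes "(gen_step D)\<^sup>*\<^sup>* s t"
    and "dg_edges D \<subseteq> dg_nodes D \<times> G \<times> dg_nodes D"
    and "snd s \<subseteq> fst s" "fst s \<subseteq> dg_nodes D" "dg_init D \<in> fst s"
  shows "snd t \<subseteq> fst t \<and> fst t \<subseteq> dg_nodes D \<and> dg_init D \<in> fst t"
  using assms(1)
proof induction
  case base
  then show ?case using assms by blast
next
  case (step t u)
  from step.hyps(2) step.IH show ?case
    using assms(2) by cases auto
qed

lemma wfp_gen_step:
  assumes fin: "finite (dg_nodes D)"
    and E: "dg_edges D \<subseteq> dg_nodes D \<times> G \<times> dg_nodes D"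
  shows "wfp (\<lambda>t s. gen_step D s t \<and> snd s \<subseteq> fst s \<and> fst s \<subseteq> dg_nodes D)"
proof -
  let ?r = "inv_image (less_than <*lex*> less_than)
              (\<lambda>(Q, W). (card (dg_nodes D - Q), card W))"
  have "(t, s) \<in> ?r" if st: "gen_step D s t" and sub: "snd s \<subseteq> fst s" "fst s \<subseteq> dg_nodes D" for s t
    using st
  proof cases
    case (1 n\<^sub>s W new Q)
    show ?thesis
    proof (cases "new = {}")
      case True
      have "finite W" using 1 sub fin by (auto intro: finite_subset)
      then have "card (W - {n\<^sub>s}) < card W" using 1 by (meson card_Diff1_less)
      then show ?thesis using 1(1,2) True by auto
    next
      case False
      then have "dg_nodes D - (Q \<union> new) \<subset> dg_nodes D - Q" using 1(4) E by blast
      then have "card (dg_nodes D - (Q \<union> new)) < card (dg_nodes D - Q)"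
        using fin by (intro psubset_card_mono) auto
      then show ?thesis using 1(1,2) by auto
    qed
  qed
  then have "{(t, s). gen_step D s t \<and> snd s \<subseteq> fst s \<and> fst s \<subseteq> dg_nodes D} \<subseteq> ?r"
    by blast
  moreover have "wf ?r" by (intro wf_inv_image wf_lex_prod wf_less_than)
  ultimately show ?thesis
    unfolding wfp_def by (rule wf_subset[rotated])
qed

lemma wf_condition_generates:
  assumes fin: "finite (dg_nodes D)"
    and D: "difference_graph SP P P' D" and gen: "generates P' D A"
  shows "wf_condition P' A"
proof -
  from gen obtain Q where
    Q: "(gen_step D)\<^sup>*\<^sup>* ({dg_init D} \<union> dg_indicators D, {dg_init D} \<union> dg_indicators D) (Q, {})"
    and A: "A = gen_output P' D Q"
    unfolding generates_def by blast
  have E: "dg_edges D \<subseteq> dg_nodes D \<times> cfa_edges P' \<times> dg_nodes D"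
    and sub: "{dg_init D} \<union> dg_indicators D \<subseteq> dg_nodes D"
    using D unfolding difference_graph_def by auto
  from gen_step_invariant[OF Q E] sub have "Q \<subseteq> dg_nodes D" "dg_init D \<in> Q" by auto
  moreover have "gen_accepting D Q \<subseteq> dg_nodes D" using E unfolding gen_accepting_def by blast
  ultimately show ?thesis
    using fin unfolding A wf_condition_def gen_output_def Let_def
    by (auto intro: finite_subset simp: gen_accepting_def)
qed

end

(* The generator saturates Q backwards along the edges, so the final Q contains every node from
   which an indicator node is reachable. An accepting state lies outside Q and hence reaches no
   indicator node, whereas the defining property of a difference graph says that every node reached
   along a prefix of a path with a regression bug does. *)

theory Submission
  imports Defs
begin

lemma run_mono: "run E n gs n' \<Longrightarrow> E \<subseteq> E' \<Longrightarrow> run E' n gs n'"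
  by (induction rule: run.induct) (auto intro: run.intros)

lemma run_backward_closed:
  assumes "run E n gs n'" and "n' \<in> Q"
    and "\<And>p g s. (p, g, s) \<in> E \<Longrightarrow> s \<in> Q \<Longrightarrow> p \<in> Q"
  shows "n \<in> Q"
  using assms by (induction rule: run.induct) blast+

lemma gen_step_mono: "(gen_step D)\<^sup>*\<^sup>* s t \<Longrightarrow> fst s \<subseteq> fst t"
  by (induction rule: rtranclp_induct) (auto elim!: gen_step.cases)

text \<open>A node leaves the waitlist only in the step that adds all its missing predecessors.
  Starting with the waitlist equal to the whole set makes the claim vacuous at first.\<close>

lemma gen_step_closed:
  assumes "(gen_step D)\<^sup>*\<^sup>* (Q, Q) t"
    and "(p, g, s) \<in> dg_edges D" and "s \<in> fst t - snd t"
  shows "p \<in> fst t"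
  using assms(1,3)
proof (induction rule: rtranclp_induct)
  case base
  then show ?case by simp
next
  case (step t u)
  \<comment> \<open>New nodes are also waiting, so \<open>s\<close> is either the node just removed
    or was already processed before this step.\<close>
  from step.hyps(2) step.IH step.prems show ?case
    using assms(2) by cases auto
qed

theorem theorem1:
  fixes SP :: "'asg \<Rightarrow> ('var, 'val) data_state \<Rightarrow> ('var, 'val) data_state"
    and P :: "('l, ('asg, 'var, 'val) operation) cfa"
    and P' :: "('m, ('asg, 'var, 'val) operation) cfa"
    and D :: "('n, 'm \<times> ('asg, 'var, 'val) operation \<times> 'm) diff_graph"
    and A :: "('n, 'm \<times> ('asg, 'var, 'val) operation \<times> 'm) condition"
  assumes "wf_cfa P" and "wf_cfa P'"
    and "difference_graph SP P P' D"
    and "generates P' D A"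
  shows "cover SP P' A \<inter> paths_rb SP P P' = {}"
proof -
  let ?Q0 = "{dg_init D} \<union> dg_indicators D"
  from assms(4) obtain Q where gen: "(gen_step D)\<^sup>*\<^sup>* (?Q0, ?Q0) (Q, {})"
    and A: "A = gen_output P' D Q"
    unfolding generates_def by blast
  have ind: "dg_indicators D \<subseteq> Q"
    using gen_step_mono[OF gen] by simp
  \<comment> \<open>On termination the waitlist is empty, so closure holds at every node of
    \<open>Q\<close>.\<close>
  have closed: "p \<in> Q" if "(p, g, s) \<in> dg_edges D" "s \<in> Q" for p g s
    using gen_step_closed[OF gen that(1)] that(2) by simp
  have "(cs, gs) \<notin> paths_rb SP P P'" if "(cs, gs) \<in> cover SP P' A" for cs gs
  proof
    assume rb: "(cs, gs) \<in> paths_rb SP P P'"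
    from that obtain k q where k: "k \<le> length gs" and q: "q \<in> accepting A"
      and "run (trans_rel A) (init_state A) (take k gs) q"
      unfolding cover_def by blast
    \<comment> \<open>The transitions of \<open>A\<close> are edges of \<open>D\<close>, and both
      start at the same node.\<close>
    then have "run (dg_edges D) (dg_init D) (take k gs) q"
      unfolding A gen_output_def Let_def by (auto elim: run_mono)
    with assms(3) rb k obtain hs n' where "n' \<in> dg_indicators D" "run (dg_edges D) q hs n'"
      unfolding difference_graph_def by fast
    with ind closed have "q \<in> Q"
      by (blast intro: run_backward_closed)
    with q show False
      unfolding A gen_output_def Let_def gen_accepting_def by simp
  qed
  then show ?thesis by auto
qed

end
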